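(* Let $\alpha\in[0,1]$ and let $\mathcal G$ be a finite group of order $n\ge3$. Then $\alpha n-1$ is an $A_\alpha$-eigenvalue of the power graph $\mathcal P(\mathcal G)$ with multiplicity at least $b-1$, where $b$ is the number of vertices of $\mathcal P(\mathcal G)$ that are adjacent to every other vertex of $\mathcal P(\mathcal G)$.
   Context: For a simple graph $G$ with adjacency matrix $A(G)$ and diagonal degree matrix $D(G)$, and $\alpha\in[0,1]$, $A_\alpha(G)=\alpha D(G)+(1-\alpha)A(G)$; an $A_\alpha$-eigenvalue is an eigenvalue of this matrix. The (undirected) power graph $\mathcal P(\mathcal G)$ of a finite group $\mathcal G$ has vertex set $\mathcal G$, two distinct elements $x,y$ being adjacent iff one is a positive power of the other. *)

theory Defs
  imports
    "HOL-Algebra.Coset"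
    "Jordan_Normal_Form.Char_Poly"
    "Graph_Theory.Pair_Digraph"
begin

text \<open>Simple graphs are represented as in Graph_Theory: an undirected edge is a pair of
  opposite arcs, so the degree of a vertex is its out-degree. The matrices of a graph are taken
  with respect to an enumeration \<open>vs\<close> of the vertices without repetition.\<close>

definition adjacency_mat :: "'a pair_pre_digraph \<Rightarrow> 'a list \<Rightarrow> real mat" where
  "adjacency_mat H vs = mat (length vs) (length vs)
     (\<lambda>(i, j). if vs ! i \<rightarrow>\<^bsub>with_proj H\<^esub> vs ! j then 1 else 0)"

definition degree_mat :: "'a pair_pre_digraph \<Rightarrow> 'a list \<Rightarrow> real mat" where
  "degree_mat H vs = mat_diag (length vs) (\<lambda>i. real (out_degree (with_proj H) (vs ! i)))"

definition A_alpha_mat :: "real \<Rightarrow> 'a pair_pre_digraph \<Rightarrow> 'a list \<Rightarrow> real mat" where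
  "A_alpha_mat \<alpha> H vs = \<alpha> \<cdot>\<^sub>m degree_mat H vs + (1 - \<alpha>) \<cdot>\<^sub>m adjacency_mat H vs"

definition power_graph :: "('a, 'b) monoid_scheme \<Rightarrow> 'a pair_pre_digraph" where
  "power_graph G = \<lparr> pverts = carrier G,
     parcs = {(x, y). x \<in> carrier G \<and> y \<in> carrier G \<and> x \<noteq> y \<and>
       (\<exists>k::nat. k > 0 \<and> (y = x [^]\<^bsub>G\<^esub> k \<or> x = y [^]\<^bsub>G\<^esub> k))} \<rparr>"

lemma pair_graph_power_graph:
  assumes "finite (carrier G)"
  shows "pair_graph (power_graph G)"
proof
  show "finite (parcs (power_graph G))"
    by (rule finite_subset[of _ "carrier G \<times> carrier G"])
      (auto simp: power_graph_def assms)
qed (auto simp: power_graph_def assms symmetric_def sym_def)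

definition dominating_vertices :: "'a pair_pre_digraph \<Rightarrow> 'a set" where
  "dominating_vertices H =
     {u \<in> pverts H. \<forall>v \<in> pverts H. v \<noteq> u \<longrightarrow> u \<rightarrow>\<^bsub>with_proj H\<^esub> v}"

text \<open>Algebraic multiplicity; for the symmetric matrices considered here it equals the
  dimension of the eigenspace. It is \<open>0\<close> iff \<open>x\<close> is not an eigenvalue.\<close>

definition eigenvalue_multiplicity :: "real mat \<Rightarrow> real \<Rightarrow> nat" where
  "eigenvalue_multiplicity A x = Polynomial.order x (char_poly A)"

end

theory Submission
  imports Defs
begin

text \<open>If two vertices are both adjacent to all others, their rows in the characteristic matrix
  of \<open>A\<^sub>\<alpha>\<close> differ by \<open>x - (\<alpha> n - 1)\<close> times a difference of unit vectors. Subtracting the row of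
  one fixed dominating vertex from those of the other \<open>b - 1\<close> makes each of these \<open>b - 1\<close> rows
  divisible by \<open>x - (\<alpha> n - 1)\<close>, so the power \<open>b - 1\<close> of this factor divides the determinant.\<close>

text \<open>Every term of the Leibniz expansion picks one entry from each row, so it contains a
  factor divisible by \<open>p\<close> for each index in \<open>T\<close>.\<close>

lemma power_dvd_det_if_dvd_rows:
  fixes M :: "'a::comm_ring_1 mat"
  assumes M: "M \<in> carrier_mat n n" and T: "T \<subseteq> {0..<n}"
    and dvd: "\<And>i j. i \<in> T \<Longrightarrow> j < n \<Longrightarrow> p dvd M $$ (i, j)"
  shows "p ^ card T dvd det M"
proof -
  have "p ^ card T dvd (\<Prod>i = 0..<n. M $$ (i, q i))" if q: "q permutes {0..<n}" for q
  proof -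
    have "p ^ card T = (\<Prod>i\<in>T. p)"
      by simp
    also have "\<dots> dvd (\<Prod>i\<in>T. M $$ (i, q i))"
    proof (rule prod_dvd_prod)
      fix i assume i: "i \<in> T"
      then have "q i < n"
        using T permutes_in_image[OF q, of i] by auto
      then show "p dvd M $$ (i, q i)"
        using dvd i by blast
    qed
    also have "\<dots> dvd (\<Prod>i = 0..<n. M $$ (i, q i))"
      using T by (intro prod_dvd_prod_subset) auto
    finally show ?thesis .
  qed
  then show ?thesis
    unfolding det_def'[OF M] by (intro dvd_sum dvd_mult) auto
qed

text \<open>The set \<open>T\<close> of rows that have already been reduced makes the induction on \<open>S\<close> go through.\<close>

lemma power_dvd_det_if_congruent_rows_aux:
  fixes M :: "'a::comm_ring_1 mat"
  assumes "finite S" and "M \<in> carrier_mat n n" and "r < n" and "S \<subseteq> {0..<n}" and "T \<subseteq> {0..<n}"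
    and "r \<notin> S" and "r \<notin> T" and "S \<inter> T = {}"
    and "\<And>i j. i \<in> T \<Longrightarrow> j < n \<Longrightarrow> p dvd M $$ (i, j)"
    and "\<And>i j. i \<in> S \<Longrightarrow> j < n \<Longrightarrow> p dvd M $$ (i, j) - M $$ (r, j)"
  shows "p ^ (card S + card T) dvd det M"
  using assms
proof (induction S arbitrary: M T rule: finite_induct)
  case empty
  then show ?case
    using power_dvd_det_if_dvd_rows[of M n T p] by simp
next
  case (insert k S)
  \<comment> \<open>Subtracting row \<open>r\<close> from row \<open>k\<close> makes row
    \<open>k\<close> divisible by \<open>p\<close>, so \<open>k\<close> passes from \<open>S\<close>
    to \<open>T\<close>.\<close>
  let ?M = "addrow (- 1) k r M"
  have k: "k < n" "k \<noteq> r" "k \<notin> T" and fin: "finite T"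
    using insert.prems finite_subset[of T "{0..<n}"] by auto
  have M: "?M \<in> carrier_mat n n"
    using insert.prems by simp
  have entry: "?M $$ (i, j) = (if i = k then M $$ (k, j) - M $$ (r, j) else M $$ (i, j))"
    if "i < n" "j < n" for i j
    using insert.prems(1) that by auto
  have "p ^ (card S + card (insert k T)) dvd det ?M"
  proof (rule insert.IH[OF M])
    show "p dvd ?M $$ (i, j)" if "i \<in> insert k T" "j < n" for i j
      using that insert.prems k by (subst entry) auto
    \<comment> \<open>Only row \<open>k\<close> has changed, and neither \<open>i\<close> nor
      \<open>r\<close> equals \<open>k\<close>, so the congruence is inherited from
      \<open>M\<close>.\<close>
    show "p dvd ?M $$ (i, j) - ?M $$ (r, j)" if "i \<in> S" "j < n" for i j
    proof -
      have "i < n" "i \<noteq> k"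
        using that insert.prems insert.hyps by auto
      then show ?thesis
        using that insert.prems k entry[of i j] entry[of r j] by auto
    qed
  qed (use insert.prems insert.hyps k in auto)
  moreover have "det ?M = det M"
    using insert.prems(1,2) k by (intro det_addrow) auto
  ultimately show ?case
    using insert.hyps k fin by simp
qed

lemma power_dvd_det_if_congruent_rows:
  fixes M :: "'a::comm_ring_1 mat"
  assumes "M \<in> carrier_mat n n" and "r < n" and "S \<subseteq> {0..<n}" and "r \<notin> S"
    and "\<And>i j. i \<in> S \<Longrightarrow> j < n \<Longrightarrow> p dvd M $$ (i, j) - M $$ (r, j)"
  shows "p ^ card S dvd det M"
  using power_dvd_det_if_congruent_rows_aux[of S M n r "{}" p] assms finite_subset[of S "{0..<n}"]
  by simp

lemma out_degree_dominating_vertex: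
  assumes "pair_graph H" and u: "u \<in> dominating_vertices H"
  shows "out_degree (with_proj H) u = card (pverts H) - 1"
proof -
  interpret pair_graph H by fact
  have "out_arcs (with_proj H) u = Pair u ` (pverts H - {u})"
    using u
    by (auto simp: dominating_vertices_def out_arcs_def intro!: imageI dest: no_loops' in_arcsD2)
  then show ?thesis
    using u by (simp add: out_degree_def card_image inj_on_def dominating_vertices_def)
qed

text \<open>A dominating vertex has degree \<open>length vs - 1\<close> and, as there are no loops,
  its adjacency row is 1 everywhere off the diagonal.\<close>

lemma A_alpha_mat_dominating_row:
  assumes "pair_graph H" and "distinct vs" and "set vs = pverts H"
    and i: "i < length vs" and j: "j < length vs" and u: "vs ! i \<in> dominating_vertices H"
  shows "A_alpha_mat \<alpha> H vs $$ (i, j)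
    = (if i = j then \<alpha> * (real (length vs) - 1) else 1 - \<alpha>)"
proof -
  interpret pair_graph H by fact
  have deg: "real (out_degree (with_proj H) (vs ! i)) = real (length vs) - 1"
    using out_degree_dominating_vertex[OF assms(1) u] distinct_card[OF assms(2)] assms(3) i
    by (simp add: of_nat_diff)
  have adj: "vs ! i \<rightarrow>\<^bsub>with_proj H\<^esub> vs ! j \<longleftrightarrow> i \<noteq> j"
  proof (cases "i = j")
    case True
    then show ?thesis
      using adj_not_same by auto
  next
    case False
    then have "vs ! j \<noteq> vs ! i" "vs ! j \<in> pverts H"
      using assms nth_eq_iff_index_eq nth_mem by fastforce+
    then show ?thesis
      using u False by (auto simp: dominating_vertices_def)
  qed
  show ?thesis
    using i j deg adj
    by (auto simp: A_alpha_mat_def degree_mat_def adjacency_mat_def mat_diag_def)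
qed

lemma A_alpha_multiplicity_dominating:
  assumes H: "pair_graph H" and dist: "distinct vs" and set: "set vs = pverts H"
  shows "card (dominating_vertices H) - 1
    \<le> eigenvalue_multiplicity (A_alpha_mat \<alpha> H vs) (\<alpha> * real (card (pverts H)) - 1)"
proof (cases "dominating_vertices H = {}")
  case False
  define n where "n = length vs"
  define A where "A = A_alpha_mat \<alpha> H vs"
  define p :: "real poly" where "p = [:- (\<alpha> * real n - 1), 1:]"
  \<comment> \<open>Rows are indexed by positions in \<open>vs\<close>, so dominating vertices are
    replaced by their positions; \<open>vs\<close> being distinct preserves their number.\<close>
  define B where "B = {i. i < n \<and> vs ! i \<in> dominating_vertices H}"
  have n: "card (pverts H) = n"
    using distinct_card[OF dist] set n_def by simp
  have A: "A \<in> carrier_mat n n"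
    by (simp add: A_def A_alpha_mat_def degree_mat_def adjacency_mat_def n_def)
  have im: "(!) vs ` B = dominating_vertices H"
  proof
    show "dominating_vertices H \<subseteq> (!) vs ` B"
    proof
      fix u assume u: "u \<in> dominating_vertices H"
      then have "u \<in> set vs"
        by (simp add: set dominating_vertices_def)
      then obtain i where "i < n" "vs ! i = u"
        unfolding n_def in_set_conv_nth by blast
      then show "u \<in> (!) vs ` B"
        using u unfolding B_def by blast
    qed
  qed (auto simp: B_def)
  have "inj_on ((!) vs) B"
    using dist by (auto simp: inj_on_def B_def n_def nth_eq_iff_index_eq)
  then have card: "card B = card (dominating_vertices H)"
    using card_image im by metis
  obtain r where r: "r \<in> B"
    using im False by auto
  have M: "char_poly_matrix A \<in> carrier_mat n n"
    using A by simp
  have "p ^ card (B - {r}) dvd det (char_poly_matrix A)"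
  proof (rule power_dvd_det_if_congruent_rows[OF M, of r])
    fix i j assume i: "i \<in> B - {r}" and j: "j < n"
    have row: "char_poly_matrix A $$ (k, j)
      = (if k = j then [:- (\<alpha> * (real n - 1)), 1:] else [:- (1 - \<alpha>):])" if "k \<in> B" for k
      using that j A A_alpha_mat_dominating_row[OF H dist set, of k j \<alpha>]
      by (auto simp: char_poly_matrix_def A_def B_def n_def)
    \<comment> \<open>In column \<open>i\<close> the difference is x - \<alpha>(n - 1) + (1 -
      \<alpha>) = x - (\<alpha>n - 1), which is \<open>p\<close>; column \<open>r\<close> gives its
      negative, and all other columns cancel.\<close>
    have "char_poly_matrix A $$ (i, j) - char_poly_matrix A $$ (r, j)
      = (if j = i then p else if j = r then - p else 0)"
      using i r row[of i] row[of r] by (auto simp: p_def algebra_simps)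
    then show "p dvd char_poly_matrix A $$ (i, j) - char_poly_matrix A $$ (r, j)"
      by simp
  qed (use r in \<open>auto simp: B_def\<close>)
  then have "p ^ (card B - 1) dvd char_poly A"
    using r by (simp add: char_poly_def B_def)
  \<comment> \<open>A power of \<open>p\<close> dividing a polynomial bounds the order of the root
    from below only if that polynomial is nonzero.\<close>
  moreover have "char_poly A \<noteq> 0"
    using degree_monic_char_poly[OF A] by auto
  ultimately have "card B - 1 \<le> Polynomial.order (\<alpha> * real n - 1) (char_poly A)"
    unfolding p_def order_divides by blast
  then show ?thesis
    by (simp add: card n A_def eigenvalue_multiplicity_def)
\<comment> \<open>Without dominating vertices the truncated difference \<open>0 - 1\<close> is 0, so
  the bound is trivial.\<close>
qed simp

theorem theorem3p1:
  fixes G :: "('a, 'b) monoid_scheme" and \<alpha> :: real and n b :: nat and vs :: "'a list"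
  assumes "0 \<le> \<alpha>" and "\<alpha> \<le> 1"
    and "group G" and "finite (carrier G)"
    and "n = Coset.order G" and "n \<ge> 3"
    and "distinct vs" and "set vs = pverts (power_graph G)"
    and "b = card (dominating_vertices (power_graph G))"
  shows "(b - 1 \<ge> 1 \<longrightarrow>
            eigenvalue (A_alpha_mat \<alpha> (power_graph G) vs) (\<alpha> * real n - 1))
         \<and> eigenvalue_multiplicity (A_alpha_mat \<alpha> (power_graph G) vs) (\<alpha> * real n - 1) \<ge> b - 1"
proof -
  let ?A = "A_alpha_mat \<alpha> (power_graph G) vs" and ?x = "\<alpha> * real n - 1"
  have n: "card (pverts (power_graph G)) = n"
    using assms(5) by (simp add: power_graph_def Coset.order_def)
  have mult: "b - 1 \<le> eigenvalue_multiplicity ?A ?x"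
    using A_alpha_multiplicity_dominating[OF pair_graph_power_graph[OF assms(4)] assms(7,8)]
    unfolding n assms(9) .
  have A: "?A \<in> carrier_mat (length vs) (length vs)"
    by (simp add: A_alpha_mat_def degree_mat_def adjacency_mat_def)
  have "eigenvalue ?A ?x" if "b - 1 \<ge> 1"
  proof -
    \<comment> \<open>Positive order makes \<open>?x\<close> a root of the characteristic
      polynomial, hence an eigenvalue.\<close>
    have "Polynomial.order ?x (char_poly ?A) \<noteq> 0"
      using mult that by (simp add: eigenvalue_multiplicity_def)
    then show ?thesis
      using eigenvalue_root_char_poly[OF A] order_root by blast
  qed
  with mult show ?thesis
    by blast
qed

end
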